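(* Let $(J,g)$ be a Hermitian structure on a $2n$-dimensional almost abelian Lie algebra $\mathfrak g$. If $(J,g)$ is both balanced and LCSKT, then it is necessarily Kähler.
   Context: A real Lie algebra is almost abelian if it contains a codimension-one abelian ideal. A Hermitian structure $(J,g)$ on $\mathfrak g$ consists of an endomorphism $J$ with $J^2=-\mathrm{Id}$ and $[JX,JY]-J[JX,Y]-J[X,JY]-[X,Y]=0$ for all $X,Y$, and an inner product $g$ with $g(JX,JY)=g(X,Y)$. Let $\Omega(X,Y)=g(JX,Y)$ be the fundamental form and $d$ the Chevalley–Eilenberg differential. The structure is Kähler if $d\Omega=0$. The Lee form $\theta$ is the unique $1$-form with $d\Omega^{n-1}=(n-1)\theta\wedge\Omega^{n-1}$, and the structure is balanced if $\theta=0$. The Bismut torsion $3$-form is $H=d^c\Omega$, i.e. $H(X,Y,Z)=-d\Omega(JX,JY,JZ)$. $(J,g)$ is LCSKT if there is a non-zero closed $1$-form $\alpha$ on $\mathfrak g$ with $dH=\alpha\wedge H$. *)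

theory Defs
  imports "HOL-Analysis.Analysis"
begin

locale real_lie_algebra =
  fixes br :: "'a::real_vector \<Rightarrow> 'a \<Rightarrow> 'a"
  assumes bilinear_br: "bilinear br"
    and br_self: "br x x = 0"
    and jacobi: "br x (br y z) + br y (br z x) + br z (br x y) = 0"

definition lie_ideal :: "('a::real_vector \<Rightarrow> 'a \<Rightarrow> 'a) \<Rightarrow> 'a set \<Rightarrow> bool" where
  "lie_ideal br I \<longleftrightarrow> subspace I \<and> (\<forall>x. \<forall>y\<in>I. br x y \<in> I)"

text \<open>Since \<open>dim\<close> is \<open>0\<close> on infinite-dimensional spaces, the dimension equation
  also forces the Lie algebra to be finite-dimensional and non-zero.\<close>

definition almost_abelian :: "('a::real_vector \<Rightarrow> 'a \<Rightarrow> 'a) \<Rightarrow> bool" where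
  "almost_abelian br \<longleftrightarrow>
     (\<exists>I. lie_ideal br I \<and> (\<forall>x\<in>I. \<forall>y\<in>I. br x y = 0) \<and> dim (UNIV :: 'a set) = dim I + 1)"

definition complex_structure :: "('a::real_vector \<Rightarrow> 'a \<Rightarrow> 'a) \<Rightarrow> ('a \<Rightarrow> 'a) \<Rightarrow> bool" where
  "complex_structure br J \<longleftrightarrow> linear J \<and> (\<forall>x. J (J x) = - x) \<and>
     (\<forall>x y. br (J x) (J y) - J (br (J x) y) - J (br x (J y)) - br x y = 0)"

definition inner_product :: "('a::real_vector \<Rightarrow> 'a \<Rightarrow> real) \<Rightarrow> bool" where
  "inner_product g \<longleftrightarrow> bilinear g \<and> (\<forall>x y. g x y = g y x) \<and> (\<forall>x. x \<noteq> 0 \<longrightarrow> g x x > 0)"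

definition hermitian_structure ::
  "('a::real_vector \<Rightarrow> 'a \<Rightarrow> 'a) \<Rightarrow> ('a \<Rightarrow> 'a) \<Rightarrow> ('a \<Rightarrow> 'a \<Rightarrow> real) \<Rightarrow> bool" where
  "hermitian_structure br J g \<longleftrightarrow>
     complex_structure br J \<and> inner_product g \<and> (\<forall>x y. g (J x) (J y) = g x y)"


text \<open>A \<open>k\<close>-form is encoded by its values on lists of \<open>k\<close> vectors, extended by \<open>0\<close> to lists of
  every other length; all operations below preserve this convention, so that equality of forms
  is equality of functions and no degree has to be passed around.\<close>

type_synonym 'a form = "'a list \<Rightarrow> real"

definition zero_form :: "'a form" where
  "zero_form = (\<lambda>xs. 0)"

definition unit_form :: "'a form" where
  "unit_form xs = (if xs = [] then 1 else 0)"

definition one_form :: "('a \<Rightarrow> real) \<Rightarrow> 'a form" where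
  "one_form \<alpha> xs = (case xs of [x] \<Rightarrow> \<alpha> x | _ \<Rightarrow> 0)"

definition two_form :: "('a \<Rightarrow> 'a \<Rightarrow> real) \<Rightarrow> 'a form" where
  "two_form \<omega> xs = (case xs of [x, y] \<Rightarrow> \<omega> x y | _ \<Rightarrow> 0)"

text \<open>The wedge product in the normalisation \<open>(\<alpha> \<and> \<beta>) x y = \<alpha> x * \<beta> y - \<alpha> y * \<beta> x\<close>
  for \<open>1\<close>-forms, as a sum over shuffles.  A shuffle is given by the set \<open>S\<close> of positions whose
  vectors go to the left factor, and its sign is the parity of the number of inversions.
  If the left factor is a \<open>p\<close>-form, only the sets \<open>S\<close> of cardinality \<open>p\<close> contribute.\<close>

definition shuffle_sign :: "nat set \<Rightarrow> real" where
  "shuffle_sign S = (-1) ^ card {(i, j). i \<in> S \<and> j \<notin> S \<and> j < i}"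

definition wedge :: "'a form \<Rightarrow> 'a form \<Rightarrow> 'a form" where
  "wedge \<alpha> \<beta> xs =
     (\<Sum>S \<in> Pow {..<length xs}. shuffle_sign S * \<alpha> (nths xs S) * \<beta> (nths xs (- S)))"

primrec wedge_power :: "'a form \<Rightarrow> nat \<Rightarrow> 'a form" where
  "wedge_power \<omega> 0 = unit_form"
| "wedge_power \<omega> (Suc k) = wedge \<omega> (wedge_power \<omega> k)"

text \<open>The Chevalley--Eilenberg differential
  \<open>(d \<omega>) (x\<^sub>0, \<dots>, x\<^sub>k) = (\<Sum>i<j. (-1)^(i+j) * \<omega> ([x\<^sub>i, x\<^sub>j], x\<^sub>0, \<dots>, x\<^sub>k))\<close>, where \<open>x\<^sub>i\<close> and
  \<open>x\<^sub>j\<close> are omitted from the trailing arguments.\<close>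

definition ce_diff :: "('a \<Rightarrow> 'a \<Rightarrow> 'a) \<Rightarrow> 'a form \<Rightarrow> 'a form" where
  "ce_diff br \<omega> xs =
     (\<Sum>j<length xs. \<Sum>i<j. (-1) ^ (i + j) * \<omega> (br (xs ! i) (xs ! j) # nths xs (- {i, j})))"


definition fundamental_form :: "('a \<Rightarrow> 'a) \<Rightarrow> ('a \<Rightarrow> 'a \<Rightarrow> real) \<Rightarrow> 'a form" where
  "fundamental_form J g = two_form (\<lambda>x y. g (J x) y)"

definition kaehler :: "('a \<Rightarrow> 'a \<Rightarrow> 'a) \<Rightarrow> ('a \<Rightarrow> 'a) \<Rightarrow> ('a \<Rightarrow> 'a \<Rightarrow> real) \<Rightarrow> bool" where
  "kaehler br J g \<longleftrightarrow> ce_diff br (fundamental_form J g) = zero_form"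

definition is_lee_form ::
  "('a::real_vector \<Rightarrow> 'a \<Rightarrow> 'a) \<Rightarrow> ('a \<Rightarrow> 'a) \<Rightarrow> ('a \<Rightarrow> 'a \<Rightarrow> real) \<Rightarrow> nat \<Rightarrow> ('a \<Rightarrow> real) \<Rightarrow> bool" where
  "is_lee_form br J g n \<theta> \<longleftrightarrow> linear \<theta> \<and>
     ce_diff br (wedge_power (fundamental_form J g) (n - 1)) =
       (\<lambda>xs. real (n - 1) * wedge (one_form \<theta>) (wedge_power (fundamental_form J g) (n - 1)) xs)"

text \<open>In real dimension \<open>2n \<ge> 4\<close> there is exactly one Lee form, so that balanced means that
  this form is zero.  For \<open>n = 1\<close> the defining equation reads \<open>0 = 0\<close> and holds for every
  \<open>\<theta>\<close>; such structures count as balanced here.\<close>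

definition balanced ::
  "('a::real_vector \<Rightarrow> 'a \<Rightarrow> 'a) \<Rightarrow> ('a \<Rightarrow> 'a) \<Rightarrow> ('a \<Rightarrow> 'a \<Rightarrow> real) \<Rightarrow> nat \<Rightarrow> bool" where
  "balanced br J g n \<longleftrightarrow> (\<exists>\<theta>. is_lee_form br J g n \<theta> \<and> \<theta> = (\<lambda>x. 0))"

definition bismut_torsion ::
  "('a \<Rightarrow> 'a \<Rightarrow> 'a) \<Rightarrow> ('a \<Rightarrow> 'a) \<Rightarrow> ('a \<Rightarrow> 'a \<Rightarrow> real) \<Rightarrow> 'a form" where
  "bismut_torsion br J g xs = - ce_diff br (fundamental_form J g) (map J xs)"

definition lcskt ::
  "('a::real_vector \<Rightarrow> 'a \<Rightarrow> 'a) \<Rightarrow> ('a \<Rightarrow> 'a) \<Rightarrow> ('a \<Rightarrow> 'a \<Rightarrow> real) \<Rightarrow> bool" where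
  "lcskt br J g \<longleftrightarrow> (\<exists>\<alpha>. linear \<alpha> \<and> \<alpha> \<noteq> (\<lambda>x. 0) \<and> ce_diff br (one_form \<alpha>) = zero_form \<and>
     ce_diff br (bismut_torsion br J g) = wedge (one_form \<alpha>) (bismut_torsion br J g))"

end

theory Submission
  imports Defs
begin

text \<open>
  Let \<open>e\<close> be a unit normal of the codimension-one abelian ideal, \<open>D = [e, \<cdot>]\<close>, and call a vector
  tangent if it is orthogonal to \<open>e\<close> and \<open>J e\<close>. The ideal is spanned by \<open>J e\<close> and the tangent
  vectors, and integrability of \<open>J\<close> makes \<open>D\<close> preserve the tangent vectors and commute with \<open>J\<close>
  there. All brackets are determined by \<open>D\<close>, namely
  \<open>[x, y] = g(x, e) D y - g(y, e) D x\<close>, whence \<open>d\<Omega> = - e\<^sup>* \<and> \<delta>\<close> for the dual form \<open>e\<^sup>* = g(\<cdot>, e)\<close> and the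
  2-form \<open>\<delta>(x, y) = \<Omega>(D x, y) + \<Omega>(x, D y)\<close>, called \<open>defect\<close> below. So the structure is Kaehler as soon as
  \<open>\<delta>\<close> vanishes on the ideal. On tangent vectors \<open>\<delta>(x, y) = s(J x, y)\<close>, where
  \<open>s(x, y) = g(D x, y) + g(x, D y)\<close> is twice the symmetric part of \<open>D\<close>; moreover \<open>\<delta>(J e, y) = \<Omega>(D(J e), y)\<close>
  for tangent \<open>y\<close>.

  Being balanced means \<open>d\<Omega>\<^sup>n\<^sup>-\<^sup>1 = 0\<close>. Evaluated on \<open>e\<close> and a unitary frame of the tangent space, this
  says that \<open>D\<close> has trace zero there, as \<open>D\<close> acts on a top-degree form through its trace
  (\<open>balanced_imp_trace_zero\<close>). Evaluated on \<open>e\<close>, \<open>J e\<close> and a unitary frame with one vector \<open>f\<close> left out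
  (but \<open>J f\<close> kept), it says that \<open>D(J e)\<close> is orthogonal to \<open>f\<close>
  (\<open>balanced_imp_D_J_e_orthogonal\<close>). Hence \<open>\<delta>(J e, y) = 0\<close> for tangent \<open>y\<close>.

  The equation \<open>dH = \<alpha> \<and> H\<close>, evaluated on \<open>e\<close>, \<open>J e\<close> and two tangent vectors, now reads
  \<open>\<delta>(D x, y) + \<delta>(x, D y) = \<mu> \<delta>(x, y)\<close> with a constant \<open>\<mu>\<close> (\<open>lcskt_imp_defect_conformal\<close>), and
  the same holds for \<open>s\<close>. Taking the trace and using that \<open>D\<close> is trace-free gives that the sum of the
  squares of the matrix entries of \<open>s\<close> vanishes
  (\<open>symmetrization_zero_if_conformal\<close>). Thus \<open>s = 0\<close>, and \<open>\<delta>\<close> vanishes on the ideal.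

  The powers of \<open>\<Omega>\<close> are computed without permuting arguments: contraction with the first argument
  is an antiderivation of the wedge product (\<open>wedge_Cons\<close>), which gives
  \<open>\<iota>\<^sub>x \<omega>\<^sup>k\<^sup>+\<^sup>1 = (k + 1) \<iota>\<^sub>x\<omega> \<and> \<omega>\<^sup>k\<close> and lets pairs of a unitary frame be split off one at a time.
\<close>

section \<open>Wedge products by contraction\<close>

definition contract :: "'a \<Rightarrow> 'a form \<Rightarrow> 'a form" where
  "contract x \<alpha> ys = \<alpha> (x # ys)"

lemma wedge_Nil: "wedge \<alpha> \<beta> [] = \<alpha> [] * \<beta> []"
  by (simp add: wedge_def shuffle_sign_def)

lemma Pow_lessThan_Suc:
  "Pow {..<Suc n} = (\<lambda>S. insert 0 (Suc ` S)) ` Pow {..<n} \<union> (`) Suc ` Pow {..<n}"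
  unfolding lessThan_Suc_eq_insert_0 Pow_insert image_Pow_surj[OF refl, symmetric]
  by (auto simp: image_image)

text \<open>Position \<open>0\<close> takes part in an inversion exactly if it goes to the right factor, and then with
  every position of the left factor. This is the origin of the sign in \<open>wedge_Cons\<close>.\<close>

lemma shuffle_sign_insert_0: "shuffle_sign (insert 0 (Suc ` S)) = shuffle_sign S"
proof -
  have "{(i, j). i \<in> insert 0 (Suc ` S) \<and> j \<notin> insert 0 (Suc ` S) \<and> j < i} =
      map_prod Suc Suc ` {(i, j). i \<in> S \<and> j \<notin> S \<and> j < i}" (is "?L = ?R")
  proof (rule set_eqI)
    fix p :: "nat \<times> nat"
    obtain i j where p: "p = (i, j)" by (cases p)
    show "p \<in> ?L \<longleftrightarrow> p \<in> ?R"
      unfolding p by (cases i; cases j) (auto simp: image_iff)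
  qed
  then show ?thesis
    unfolding shuffle_sign_def by (simp add: card_image inj_on_def)
qed

lemma shuffle_sign_Suc_image:
  assumes "finite S"
  shows "shuffle_sign (Suc ` S) = (-1) ^ card S * shuffle_sign S"
proof -
  let ?inv = "\<lambda>S. {(i, j). i \<in> S \<and> j \<notin> S \<and> j < (i :: nat)}"
  have "?inv (Suc ` S) = (\<lambda>i. (Suc i, 0)) ` S \<union> map_prod Suc Suc ` ?inv S" (is "?L = ?R")
  proof (rule set_eqI)
    fix p :: "nat \<times> nat"
    obtain i j where p: "p = (i, j)" by (cases p)
    show "p \<in> ?L \<longleftrightarrow> p \<in> ?R"
      unfolding p by (cases i; cases j) (auto simp: image_iff)
  qed
  moreover have "finite (?inv S)"
    by (rule finite_subset[of _ "S \<times> (\<Union>i\<in>S. {..<i})"]) (use assms in auto)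
  ultimately have "card (?inv (Suc ` S)) = card S + card (?inv S)"
    using assms by (subst \<open>?L = ?R\<close>, subst card_Un_disjoint) (auto simp: card_image inj_on_def)
  then show ?thesis
    unfolding shuffle_sign_def by (simp add: power_add)
qed

text \<open>The first vector goes either to the left or to the right factor; moving it past a left factor
  of degree \<open>p\<close> costs the sign \<open>(-1)\<^sup>p\<close>. As forms carry no degree, that sign has to be read off
  the length of the argument list. All later computations with wedge products rest on this
  recursion instead of the sum over shuffles.\<close>

lemma wedge_Cons:
  "wedge \<alpha> \<beta> (x # xs) =
     wedge (contract x \<alpha>) \<beta> xs + wedge (\<lambda>ys. (-1) ^ length ys * \<alpha> ys) (contract x \<beta>) xs"
proof -
  let ?n = "length xs"
  let ?t = "\<lambda>S. shuffle_sign S * \<alpha> (nths (x # xs) S) * \<beta> (nths (x # xs) (- S))"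
  let ?i = "\<lambda>S. insert 0 (Suc ` S)"
  have inj: "inj_on ?i (Pow {..<?n})"
  proof (rule inj_onI)
    fix S T assume "?i S = ?i T"
    then have "Suc ` S = Suc ` T" by auto
    then show "S = T" by (simp add: inj_image_eq_iff)
  qed
  have inj': "inj_on ((`) Suc) (Pow {..<?n})"
    by (simp add: inj_on_def inj_image_eq_iff)
  have compl: "{j. Suc j \<in> - (Suc ` S)} = - S" "{j. Suc j \<in> - ?i S} = - S"
    "{j. Suc j \<in> ?i S} = S" "{j. Suc j \<in> Suc ` S} = S" "{j. Suc j \<notin> Suc ` S} = - S" for S
    by auto
  have "wedge \<alpha> \<beta> (x # xs) = (\<Sum>S\<in>Pow {..<Suc ?n}. ?t S)"
    by (simp add: wedge_def)
  also have "\<dots> = (\<Sum>S\<in>?i ` Pow {..<?n}. ?t S) + (\<Sum>S\<in>(`) Suc ` Pow {..<?n}. ?t S)"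
    unfolding Pow_lessThan_Suc by (rule sum.union_disjoint) auto
  also have "(\<Sum>S\<in>?i ` Pow {..<?n}. ?t S) = (\<Sum>S\<in>Pow {..<?n}. ?t (?i S))"
    by (simp add: sum.reindex[OF inj] del: Pow_iff)
  also have "\<dots> = wedge (contract x \<alpha>) \<beta> xs"
    unfolding wedge_def
    by (rule sum.cong) (auto simp: shuffle_sign_insert_0 nths_Cons compl contract_def)
  also have "(\<Sum>S\<in>(`) Suc ` Pow {..<?n}. ?t S) = (\<Sum>S\<in>Pow {..<?n}. ?t (Suc ` S))"
    by (simp add: sum.reindex[OF inj'] del: Pow_iff)
  also have "\<dots> = wedge (\<lambda>ys. (-1) ^ length ys * \<alpha> ys) (contract x \<beta>) xs"
    unfolding wedge_def
  proof (rule sum.cong[OF refl])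
    fix S assume "S \<in> Pow {..<?n}"
    then have "finite S" and "{i. i < ?n \<and> i \<in> S} = S"
      using finite_subset[of S "{..<?n}"] by auto
    then show "?t (Suc ` S) = shuffle_sign S * ((-1) ^ length (nths xs S) * \<alpha> (nths xs S)) *
        contract x \<beta> (nths xs (- S))"
      by (auto simp: shuffle_sign_Suc_image nths_Cons compl contract_def length_nths)
  qed
  finally show ?thesis .
qed

lemma wedge_scale_left: "wedge (\<lambda>ys. c * \<alpha> ys) \<beta> xs = c * wedge \<alpha> \<beta> xs"
  by (simp add: wedge_def sum_distrib_left algebra_simps)

lemma wedge_scale_right: "wedge \<alpha> (\<lambda>ys. c * \<beta> ys) xs = c * wedge \<alpha> \<beta> xs"
  by (simp add: wedge_def sum_distrib_left algebra_simps)

lemma wedge_add_right: "wedge \<alpha> (\<lambda>ys. \<beta> ys + \<gamma> ys) xs = wedge \<alpha> \<beta> xs + wedge \<alpha> \<gamma> xs"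
  by (simp add: wedge_def sum.distrib algebra_simps)

lemma wedge_diff_right: "wedge \<alpha> (\<lambda>ys. \<beta> ys - \<gamma> ys) xs = wedge \<alpha> \<beta> xs - wedge \<alpha> \<gamma> xs"
  by (simp add: wedge_def sum_subtractf algebra_simps)

lemma wedge_zero_left: "wedge (\<lambda>ys. 0) \<beta> xs = 0"
  by (simp add: wedge_def)

lemma wedge_cong_right:
  assumes "\<And>ys. set ys \<subseteq> set xs \<Longrightarrow> \<beta> ys = \<gamma> ys"
  shows "wedge \<alpha> \<beta> xs = wedge \<alpha> \<gamma> xs"
  unfolding wedge_def by (simp add: assms set_nths_subset)

lemma wedge_unit_form: "wedge (\<lambda>ys. c * unit_form ys) \<beta> xs = c * \<beta> xs"
proof (induction xs arbitrary: \<beta>)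
  case Nil
  then show ?case by (simp add: wedge_Nil unit_form_def)
next
  case (Cons x xs)
  have "contract x (\<lambda>ys. c * unit_form ys) = (\<lambda>ys::'a list. 0)"
    by (simp add: contract_def unit_form_def fun_eq_iff)
  moreover have "(\<lambda>ys::'a list. (-1) ^ length ys * (c * unit_form ys)) = (\<lambda>ys. c * unit_form ys)"
    by (simp add: unit_form_def fun_eq_iff)
  ultimately show ?case
    by (simp only: wedge_Cons wedge_zero_left Cons.IH contract_def)
qed

lemma wedge_one_form_Nil: "wedge (one_form \<eta>) \<beta> [] = 0"
  by (simp add: wedge_Nil one_form_def)

lemma wedge_one_form_Cons:
  "wedge (one_form \<eta>) \<beta> (x # xs) = \<eta> x * \<beta> xs - wedge (one_form \<eta>) (contract x \<beta>) xs"
proof -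
  have "contract x (one_form \<eta>) = (\<lambda>ys. \<eta> x * unit_form ys)"
    by (auto simp: contract_def one_form_def unit_form_def fun_eq_iff split: list.split)
  moreover have "(\<lambda>ys. (-1) ^ length ys * one_form \<eta> ys) = (\<lambda>ys. (-1) * one_form \<eta> ys)"
    by (auto simp: one_form_def fun_eq_iff split: list.split)
  ultimately show ?thesis
    by (simp add: wedge_Cons wedge_unit_form wedge_scale_left[of "-1", simplified])
qed

lemma wedge_two_form_Nil: "wedge (two_form \<omega>) \<beta> [] = 0"
  by (simp add: wedge_Nil two_form_def)

lemma wedge_two_form_Cons:
  "wedge (two_form \<omega>) \<beta> (x # xs) =
     wedge (one_form (\<omega> x)) \<beta> xs + wedge (two_form \<omega>) (contract x \<beta>) xs"
proof -
  have "contract x (two_form \<omega>) = one_form (\<omega> x)"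
    by (auto simp: contract_def one_form_def two_form_def fun_eq_iff split: list.split)
  moreover have "(\<lambda>ys. (-1) ^ length ys * two_form \<omega> ys) = two_form \<omega>"
    by (auto simp: two_form_def fun_eq_iff split: list.split)
  ultimately show ?thesis
    by (simp add: wedge_Cons)
qed

lemma contract_wedge_one_form:
  "contract x (wedge (one_form \<eta>) \<beta>) =
     (\<lambda>ys. \<eta> x * \<beta> ys - wedge (one_form \<eta>) (contract x \<beta>) ys)"
  by (simp add: fun_eq_iff contract_def[of x "wedge _ _"] wedge_one_form_Cons)

lemma contract_wedge_two_form:
  "contract x (wedge (two_form \<omega>) \<beta>) =
     (\<lambda>ys. wedge (one_form (\<omega> x)) \<beta> ys + wedge (two_form \<omega>) (contract x \<beta>) ys)"
  by (simp add: fun_eq_iff contract_def[of x "wedge _ _"] wedge_two_form_Cons)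

text \<open>The two commutation rules below hold because both sides satisfy the same recursion under
  contraction with the first argument.\<close>

lemma one_forms_anticommute:
  "wedge (one_form \<eta>) (wedge (one_form \<xi>) \<beta>) xs = - wedge (one_form \<xi>) (wedge (one_form \<eta>) \<beta>) xs"
proof (induction xs arbitrary: \<beta>)
  case Nil
  then show ?case by (simp add: wedge_one_form_Nil)
next
  case (Cons x xs)
  show ?case
    using Cons.IH[of "contract x \<beta>"]
    by (simp add: wedge_one_form_Cons contract_wedge_one_form wedge_diff_right wedge_scale_right)
qed

lemma two_form_commutes_with_one_form:
  "wedge (two_form \<omega>) (wedge (one_form \<xi>) \<beta>) xs = wedge (one_form \<xi>) (wedge (two_form \<omega>) \<beta>) xs"
proof (induction xs arbitrary: \<beta>)
  case Nil
  then show ?case by (simp add: wedge_one_form_Nil wedge_two_form_Nil)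
next
  case (Cons x xs)
  show ?case
    using Cons.IH[of "contract x \<beta>"] one_forms_anticommute[of "\<omega> x" \<xi> \<beta> xs]
    by (simp add: wedge_one_form_Cons wedge_two_form_Cons contract_wedge_one_form
        contract_wedge_two_form wedge_diff_right wedge_add_right wedge_scale_right)
qed

lemma wedge_one_form_eq_0:
  assumes "\<And>y. y \<in> set xs \<Longrightarrow> \<eta> y = 0"
  shows "wedge (one_form \<eta>) \<beta> xs = 0"
  using assms by (induction xs arbitrary: \<beta>) (auto simp: wedge_one_form_Nil wedge_one_form_Cons)


section \<open>Powers of a two-form\<close>

text \<open>Contraction with \<open>x\<close> acts as a derivation on the even-degree form \<open>\<omega>\<close>, and \<open>\<omega>\<close> commutes with
  the one-form \<open>\<omega> x\<close>, so the \<open>k + 1\<close> factors contribute equally.\<close>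

lemma contract_wedge_power:
  "contract x (wedge_power (two_form \<omega>) (Suc k)) =
     (\<lambda>ys. real (Suc k) * wedge (one_form (\<omega> x)) (wedge_power (two_form \<omega>) k) ys)"
proof (induction k)
  case 0
  have "contract x unit_form = (\<lambda>ys. 0 * unit_form ys)"
    by (simp add: fun_eq_iff contract_def unit_form_def)
  then show ?case
    by (simp only: wedge_power.simps contract_wedge_two_form wedge_scale_right) simp
next
  case (Suc k)
  have "contract x (wedge_power (two_form \<omega>) (Suc (Suc k))) =
      (\<lambda>ys. wedge (one_form (\<omega> x)) (wedge_power (two_form \<omega>) (Suc k)) ys +
        wedge (two_form \<omega>) (contract x (wedge_power (two_form \<omega>) (Suc k))) ys)"
    by (simp only: wedge_power.simps(2)[of _ "Suc k"] contract_wedge_two_form)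
  also have "\<dots> = (\<lambda>ys. real (Suc (Suc k)) *
      wedge (one_form (\<omega> x)) (wedge_power (two_form \<omega>) (Suc k)) ys)"
    unfolding Suc.IH wedge_scale_right two_form_commutes_with_one_form
    by (simp add: algebra_simps)
  finally show ?case .
qed

lemma wedge_power_Cons:
  "wedge_power (two_form \<omega>) (Suc k) (x # xs) =
     real (Suc k) * wedge (one_form (\<omega> x)) (wedge_power (two_form \<omega>) k) xs"
  using contract_wedge_power[of x \<omega> k] by (metis contract_def)

lemma wedge_power_isolated:
  assumes "\<And>z. z \<in> set xs \<Longrightarrow> \<omega> y z = 0"
  shows "wedge_power (two_form \<omega>) k (y # xs) = 0"
proof (cases k)
  case 0
  then show ?thesis by (simp add: unit_form_def)
next
  case (Suc j)
  then show ?thesis by (simp only: wedge_power_Cons wedge_one_form_eq_0[OF assms] mult_zero_right)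
qed

text \<open>A vector that pairs to zero with all other arguments but one must be paired with that one, so
  the power of \<open>\<omega>\<close> factors.\<close>

lemma wedge_power_split_pair:
  assumes "\<And>z. z \<in> set xs \<Longrightarrow> \<omega> y z = 0"
  shows "wedge_power (two_form \<omega>) (Suc k) (x # y # xs) =
    real (Suc k) * \<omega> x y * wedge_power (two_form \<omega>) k xs"
proof -
  let ?W = "wedge_power (two_form \<omega>)"
  have "contract y (?W k) zs = 0" if "set zs \<subseteq> set xs" for zs
    using that wedge_power_isolated[of zs \<omega> y k] assms by (auto simp: contract_def)
  then have "wedge (one_form (\<omega> x)) (contract y (?W k)) xs = wedge (one_form (\<omega> x)) (\<lambda>zs. 0 * unit_form zs) xs"
    by (intro wedge_cong_right) auto
  then show ?thesis
    by (simp only: wedge_power_Cons wedge_one_form_Cons wedge_scale_right) simp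
qed

text \<open>The vector \<open>w\<close> may pair nontrivially with \<open>x\<close> or \<open>y\<close>, but such a pairing leaves the other of
  these two vectors isolated and so contributes nothing.\<close>

lemma wedge_power_split_later_pair:
  assumes x: "\<And>z. z \<in> set xs \<Longrightarrow> \<omega> x z = 0" and y: "\<And>z. z \<in> set xs \<Longrightarrow> \<omega> y z = 0"
  shows "wedge_power (two_form \<omega>) (Suc k) (w # x # y # xs) =
    real (Suc k) * \<omega> x y * wedge_power (two_form \<omega>) k (w # xs)"
proof -
  let ?W = "wedge_power (two_form \<omega>)"
  have "wedge (one_form (\<omega> w)) (contract y (contract x (?W k))) xs = \<omega> x y * ?W k (w # xs)"
  proof (cases k)
    case 0
    then have "contract y (contract x (?W k)) = (\<lambda>zs. 0 * unit_form zs)"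
      by (simp add: fun_eq_iff contract_def unit_form_def)
    then show ?thesis
      unfolding 0 by (simp add: wedge_scale_right[of _ 0, simplified] unit_form_def)
  next
    case (Suc j)
    have "contract y (contract x (?W k)) zs = real (Suc j) * \<omega> x y * ?W j zs"
      if "set zs \<subseteq> set xs" for zs
      using that wedge_power_split_pair[of zs \<omega> y j x] y Suc by (auto simp: contract_def)
    then have "wedge (one_form (\<omega> w)) (contract y (contract x (?W k))) xs =
        wedge (one_form (\<omega> w)) (\<lambda>zs. real (Suc j) * \<omega> x y * ?W j zs) xs"
      by (rule wedge_cong_right)
    then show ?thesis
      unfolding Suc by (simp only: wedge_scale_right wedge_power_Cons mult_ac)
  qed
  moreover have "?W k (y # xs) = 0" "contract x (?W k) xs = 0"
    using wedge_power_isolated[of xs \<omega> _ k] x y by (auto simp only: contract_def)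
  ultimately show ?thesis
    by (simp only: wedge_power_Cons[of \<omega> k w] wedge_one_form_Cons) simp
qed


section \<open>The Chevalley--Eilenberg differential\<close>

lemma nths_Cons_Compl:
  "nths (y # ys) (- {0}) = ys" "nths (y # ys) (- {Suc j}) = y # nths ys (- {j})"
proof -
  have *: "{k. Suc k \<in> - {0}} = UNIV" "{k. Suc k \<in> - {Suc j}} = - {j}" by auto
  show "nths (y # ys) (- {0}) = ys" "nths (y # ys) (- {Suc j}) = y # nths ys (- {j})"
    by (simp_all only: nths_Cons *) (auto simp: nths_all)
qed

text \<open>If the trailing arguments commute with one another, only their brackets with \<open>x\<close> remain:
  up to sign, the differential acts on them as the derivation extending \<open>br x\<close>.\<close>

lemma ce_diff_Cons_abelian:
  assumes ab: "\<And>y z. y \<in> set xs \<Longrightarrow> z \<in> set xs \<Longrightarrow> br y z = 0"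
    and zero: "\<And>ys. \<omega> (0 # ys) = 0"
  shows "ce_diff br \<omega> (x # xs) =
    - (\<Sum>j<length xs. (-1) ^ j * \<omega> (br x (xs ! j) # nths xs (- {j})))"
proof -
  have "{i. Suc i \<in> - {0, Suc j}} = - {j}" for j :: nat
    by auto
  then have "nths (x # xs) (- {0, Suc j}) = nths xs (- {j})" for j
    by (simp add: nths_Cons)
  then have "(\<Sum>i<Suc j. (-1) ^ (i + Suc j) *
      \<omega> (br ((x # xs) ! i) ((x # xs) ! Suc j) # nths (x # xs) (- {i, Suc j}))) =
      - ((-1) ^ j * \<omega> (br x (xs ! j) # nths xs (- {j})))" if "j < length xs" for j
    using that by (simp add: sum.lessThan_Suc_shift ab zero del: sum.lessThan_Suc)
  then show ?thesis
    by (simp add: ce_diff_def sum.lessThan_Suc_shift sum_negf del: sum.lessThan_Suc)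
qed

lemma ce_diff_three:
  "ce_diff br \<omega> [x, y, z] = - \<omega> [br x y, z] + \<omega> [br x z, y] - \<omega> [br y z, x]"
  by (simp add: ce_diff_def eval_nat_numeral nths_Cons)

lemma ce_diff_four:
  "ce_diff br \<omega> [x, y, z, w] = - \<omega> [br x y, z, w] + \<omega> [br x z, y, w] - \<omega> [br x w, y, z]
     - \<omega> [br y z, x, w] + \<omega> [br y w, x, z] - \<omega> [br z w, x, y]"
  by (simp add: ce_diff_def eval_nat_numeral nths_Cons)

lemma ce_diff_two_form_length:
  assumes "length xs \<noteq> 3"
  shows "ce_diff br (two_form \<omega>) xs = 0"
proof -
  have "two_form \<omega> (br (xs ! i) (xs ! j) # nths xs (- {i, j})) = 0" if "i < j" "j < length xs" for i j
  proof -
    have "{k. k < length xs \<and> k \<in> - {i, j}} = {..<length xs} - {i, j}"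
      by auto
    then have "length (nths xs (- {i, j})) = length xs - 2"
      using that by (simp add: length_nths card_Diff_subset)
    then have "length (nths xs (- {i, j})) \<noteq> 1"
      using assms that by simp
    then show ?thesis
      by (auto simp: two_form_def split: list.split)
  qed
  then show ?thesis
    by (simp add: ce_diff_def)
qed


section \<open>Unitary frames\<close>

locale hermitian_space =
  fixes J :: "'a::real_vector \<Rightarrow> 'a" and g :: "'a \<Rightarrow> 'a \<Rightarrow> real"
  assumes linear_J: "linear J" and J_J [simp]: "J (J x) = - x"
    and inner: "inner_product g" and g_J_J [simp]: "g (J x) (J y) = g x y"
begin

lemma bilinear_g: "bilinear g"
  using inner by (simp add: inner_product_def)

lemma g_commute: "g x y = g y x"
  using inner by (simp add: inner_product_def)

lemma g_pos: "x \<noteq> 0 \<Longrightarrow> g x x > 0"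
  using inner by (simp add: inner_product_def)

lemmas g_simps [simp] = bilinear_ladd[OF bilinear_g] bilinear_radd[OF bilinear_g]
  bilinear_lsub[OF bilinear_g] bilinear_rsub[OF bilinear_g]
  bilinear_lneg[OF bilinear_g] bilinear_rneg[OF bilinear_g]
  bilinear_lzero[OF bilinear_g] bilinear_rzero[OF bilinear_g]
  bilinear_lmul[OF bilinear_g] bilinear_rmul[OF bilinear_g]

lemmas J_simps [simp] = linear_add[OF linear_J] linear_diff[OF linear_J]
  linear_neg[OF linear_J] linear_0[OF linear_J] linear_scale[OF linear_J]

lemma g_sum_left: "g (sum f B) y = (\<Sum>b\<in>B. g (f b) y)"
  using linear_sum[of "\<lambda>x. g x y" f B] bilinear_g by (simp add: bilinear_def)

lemma g_eq_0_iff: "g x x = 0 \<longleftrightarrow> x = 0"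
  using g_pos[of x] by (cases "x = 0") auto

lemma g_J_right: "g x (J y) = - g (J x) y"
  using g_J_J[of x "J y"] by simp

lemma g_J_self [simp]: "g (J x) x = 0"
  using g_J_right[of x x] g_commute[of x "J x"] by simp

lemma g_self_J [simp]: "g x (J x) = 0"
  by (simp add: g_J_right)

lemma orthogonal_span:
  assumes "\<And>b. b \<in> B \<Longrightarrow> g x b = 0" "y \<in> span B"
  shows "g x y = 0"
  using assms(2) by (induction rule: span_induct_alt) (auto simp: assms(1))

text \<open>One Gram--Schmidt step per element: \<open>c\<close> is replaced by its component \<open>d\<close> orthogonal to the
  vectors treated before.\<close>

lemma orthogonal_projection:
  assumes "finite B"
  shows "\<exists>p \<in> span B. \<forall>b\<in>B. g (x - p) b = 0"
  using assms
proof (induction B arbitrary: x)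
  case empty
  then show ?case by (auto simp: span_zero)
next
  case (insert c B)
  obtain p where p: "p \<in> span B" "\<And>b. b \<in> B \<Longrightarrow> g (x - p) b = 0"
    using insert.IH by blast
  obtain q where q: "q \<in> span B" "\<And>b. b \<in> B \<Longrightarrow> g (c - q) b = 0"
    using insert.IH by blast
  have cq: "g (x - p) q = 0" "g (c - q) q = 0"
    using p q orthogonal_span[of B] by blast+
  define d where "d = c - q"
  have gd: "g d c = g d d" using cq(2) unfolding d_def by simp
  have gx: "g (x - p) c = g (x - p) d" using cq(1) unfolding d_def by simp
  have mem: "p \<in> span (insert c B)" "d \<in> span (insert c B)"
    using p(1) q(1) span_mono[OF subset_insertI, of B c] span_base[of c "insert c B"] unfolding d_def
    by (auto intro: span_diff)
  show ?case
  proof (cases "d = 0")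
    case True
    then have "g (x - p) c = 0" using gx by simp
    then show ?thesis using p mem by blast
  next
    case False
    let ?p = "p + (g (x - p) d / g d d) *\<^sub>R d"
    have "g (x - ?p) b = g (x - p) b - g (x - p) d / g d d * g d b" for b
      by simp
    then have "g (x - ?p) b = 0" if "b \<in> insert c B" for b
      using that False p(2) q(2) gd gx g_pos[of d] by (auto simp: d_def[symmetric])
    moreover have "?p \<in> span (insert c B)"
      using mem by (intro span_add span_scale)
    ultimately show ?thesis by blast
  qed
qed

definition orthonormal :: "'a set \<Rightarrow> bool" where
  "orthonormal B \<longleftrightarrow> (\<forall>b\<in>B. \<forall>c\<in>B. g b c = (if b = c then 1 else 0))"

lemma orthonormal_independent:
  assumes "orthonormal B"
  shows "independent B"
proof
  assume "dependent B"
  then obtain b where b: "b \<in> B" "b \<in> span (B - {b})"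
    by (auto simp: dependent_def)
  have "g b b = 0"
    by (rule orthogonal_span[OF _ b(2)]) (use b(1) assms in \<open>auto simp: orthonormal_def\<close>)
  then show False
    using b(1) assms by (simp add: orthonormal_def)
qed

lemma orthonormal_residue:
  assumes "finite B" "orthonormal B" "c \<in> B"
  shows "g (x - (\<Sum>b\<in>B. g x b *\<^sub>R b)) c = 0"
proof -
  have "(\<Sum>b\<in>B. g x b * g b c) = (\<Sum>b\<in>B. if b = c then g x c else 0)"
    using assms by (intro sum.cong) (auto simp: orthonormal_def)
  then show ?thesis
    using assms by (simp add: g_sum_left)
qed

lemma orthonormal_expansion:
  assumes "finite B" "orthonormal B" "x \<in> span B"
  shows "x = (\<Sum>b\<in>B. g x b *\<^sub>R b)"
proof -
  let ?r = "x - (\<Sum>b\<in>B. g x b *\<^sub>R b)"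
  have "?r \<in> span B"
    by (rule span_diff[OF assms(3)]) (intro span_sum span_scale span_base)
  then have "g ?r ?r = 0"
    using orthogonal_span[of B ?r ?r] orthonormal_residue[OF assms(1,2)] by blast
  then have "?r = 0" by (simp only: g_eq_0_iff)
  then show ?thesis by (simp only: right_minus_eq)
qed

text \<open>Subtracting from a vector outside \<open>I\<close> its projection to \<open>I\<close> gives a normal \<open>q\<close>; by dimension, \<open>I\<close>
  and \<open>q\<close> span everything, so nothing outside \<open>I\<close> is orthogonal to \<open>q\<close>.\<close>

lemma hyperplane_unit_normal:
  assumes I: "subspace I" "dim (UNIV :: 'a set) = dim I + 1"
  obtains e where "g e e = 1" "\<And>y. y \<in> I \<longleftrightarrow> g y e = 0"
proof -
  obtain B where B: "B \<subseteq> I" "independent B" "I \<subseteq> span B" "card B = dim I"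
    using basis_exists by blast
  have span: "span B = I"
    using B(1,3) I(1) span_minimal by blast
  obtain C :: "'a set" where C: "UNIV \<subseteq> span C" "card C = dim (UNIV :: 'a set)"
    using basis_exists[of "UNIV :: 'a set"] by metis
  then have "finite C" using I(2) card_ge_0_finite[of C] by simp
  then have fin: "finite S \<and> card S \<le> dim I + 1" if "independent S" for S :: "'a set"
    using independent_span_bound[of C S] that C I(2) by auto
  have "I \<noteq> UNIV" using I(2) by auto
  then obtain x where x: "x \<notin> I" by auto
  obtain p where p: "p \<in> I" "\<And>b. b \<in> B \<Longrightarrow> g (x - p) b = 0"
    using orthogonal_projection[of B x] fin[OF B(2)] span by auto
  define q where "q = x - p"
  have q: "q \<notin> I"
    using x p(1) subspace_add[OF I(1), of p q] by (auto simp: q_def)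
  have orth: "g q y = 0" if "y \<in> I" for y
    using orthogonal_span[of B q y] p(2) that span by (auto simp: q_def)
  have pos: "g q q > 0"
    using q subspace_0[OF I(1)] by (intro g_pos) auto
  have "independent (insert q B)"
    using q span B(2) by (simp add: independent_insert)
  have all: "y \<in> span (insert q B)" for y
  proof (rule ccontr)
    assume y: "y \<notin> span (insert q B)"
    then have "independent (insert y (insert q B))"
      using \<open>independent (insert q B)\<close> by (simp add: independent_insert)
    moreover have "y \<notin> insert q B" "q \<notin> B"
      using y span_base[of y "insert q B"] q B(1) by auto
    ultimately show False
      using fin[of "insert y (insert q B)"] B(4) fin[OF B(2)] by simp
  qed
  have iff: "y \<in> I \<longleftrightarrow> g y q = 0" for y
  proof
    assume "g y q = 0"
    obtain k where k: "y - k *\<^sub>R q \<in> I"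
      using all[of y] span by (auto simp: span_insert)
    then have "g q (y - k *\<^sub>R q) = 0" by (rule orth)
    then have "k = 0"
      using \<open>g y q = 0\<close> pos by (simp add: g_commute[of q y])
    then show "y \<in> I" using k by simp
  qed (use orth[of y] g_commute[of y q] in simp)
  show ?thesis
    by (rule that[of "(1 / sqrt (g q q)) *\<^sub>R q"]) (use pos iff in auto)
qed

definition unitary :: "'a list \<Rightarrow> bool" where
  "unitary fs \<longleftrightarrow> (\<forall>f\<in>set fs. g f f = 1) \<and>
     sorted_wrt (\<lambda>f h. g f h = 0 \<and> g f (J h) = 0) fs"

text \<open>The vectors \<open>f\<close> and \<open>J f\<close> are kept adjacent because powers of the fundamental form are evaluated
  on this list by splitting off neighbouring pairs.\<close>

primrec real_frame :: "'a list \<Rightarrow> 'a list" where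
  "real_frame [] = []"
| "real_frame (f # fs) = f # J f # real_frame fs"

lemma set_real_frame: "set (real_frame fs) = set fs \<union> J ` set fs"
  by (induction fs) auto

lemma length_real_frame: "length (real_frame fs) = 2 * length fs"
  by (induction fs) auto

lemma unitary_Cons:
  "unitary (f # fs) \<longleftrightarrow> g f f = 1 \<and> (\<forall>z\<in>set (real_frame fs). g f z = 0) \<and> unitary fs"
  by (auto simp: unitary_def set_real_frame)

lemma real_frame_orthogonal:
  assumes "unitary (f # fs)" "z \<in> set (real_frame fs)"
  shows "g f z = 0" "g (J f) z = 0" "g z f = 0" "g z (J f) = 0"
proof -
  have "- J z \<in> set (real_frame fs) \<or> J z \<in> set (real_frame fs)"
    using assms(2) by (auto simp: set_real_frame)
  then have "g f (J z) = 0"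
    using assms(1) by (auto simp: unitary_Cons)
  then show "g f z = 0" "g (J f) z = 0" "g z f = 0" "g z (J f) = 0"
    using assms by (auto simp: unitary_Cons g_J_right[of f] g_commute[of z])
qed

lemma orthonormal_real_frame:
  assumes "unitary fs"
  shows "orthonormal (set (real_frame fs)) \<and> distinct (real_frame fs)"
  using assms
proof (induction fs)
  case Nil
  then show ?case by (simp add: orthonormal_def)
next
  case (Cons f fs)
  have f: "g f f = 1" "unitary fs" using Cons.prems by (auto simp: unitary_Cons)
  note orth = real_frame_orthogonal[OF Cons.prems]
  have ne: "J f \<noteq> f" using f(1) g_J_self[of f] by (metis zero_neq_one)
  have "f \<notin> set (real_frame fs)" "J f \<notin> set (real_frame fs)"
    using orth(1)[of f] orth(2)[of "J f"] f(1) by auto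
  then show ?case
    using Cons.IH[OF f(2)] f(1) orth ne by (auto simp: orthonormal_def)
qed

lemma finite_dim_independent_bound:
  assumes "dim (UNIV :: 'a set) > 0" "independent (B :: 'a set)"
  shows "card B \<le> dim (UNIV :: 'a set)"
proof -
  obtain C :: "'a set" where C: "UNIV \<subseteq> span C" "card C = dim (UNIV :: 'a set)"
    using basis_exists[of "UNIV :: 'a set"] by metis
  then have "finite C" using assms(1) card_ge_0_finite by metis
  then show ?thesis
    using independent_span_bound[of C B] assms(2) C by auto
qed

text \<open>New vectors are added in front: the residue of any vector outside the span is orthogonal to a
  set that is \<open>J\<close>-invariant up to sign, so its normalization continues the frame. The bound on the length comes from
  the independence of orthonormal sets.\<close>

lemma unitary_frame_extends:
  assumes dim: "dim (UNIV :: 'a set) = 2 * n" "n > 0" and "unitary fs"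
  shows "\<exists>hs. unitary (hs @ fs) \<and> length (hs @ fs) = n \<and> span (set (real_frame (hs @ fs))) = UNIV"
  using assms(3)
proof (induction "n - length fs" arbitrary: fs rule: less_induct)
  case less
  let ?B = "set (real_frame fs)"
  have B: "orthonormal ?B" "distinct (real_frame fs)"
    using orthonormal_real_frame[OF less.prems] by auto
  have card: "card ?B = 2 * length fs"
    using B(2) by (simp add: distinct_card length_real_frame)
  show ?case
  proof (cases "span ?B = UNIV")
    case True
    then have "dim (UNIV :: 'a set) = card ?B"
      using orthonormal_independent[OF B(1)] by (metis dim_span_eq_card_independent)
    then show ?thesis
      using True less.prems card dim by (intro exI[of _ "[]"]) auto
  next
    case False
    then obtain x where x: "x \<notin> span ?B" by auto
    let ?r = "x - (\<Sum>b\<in>?B. g x b *\<^sub>R b)"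
    have "(\<Sum>b\<in>?B. g x b *\<^sub>R b) \<in> span ?B"
      by (intro span_sum span_scale span_base)
    with x have "?r \<noteq> 0" by auto
    then have pos: "g ?r ?r > 0" by (rule g_pos)
    define f where "f = (1 / sqrt (g ?r ?r)) *\<^sub>R ?r"
    have "g f f = 1" using pos unfolding f_def
      by (simp only: bilinear_lmul[OF bilinear_g] bilinear_rmul[OF bilinear_g])
        (simp del: g_simps)
    moreover have "g f z = 0" if "z \<in> ?B" for z
      using orthonormal_residue[OF _ B(1) that, of x] unfolding f_def
      by (simp only: bilinear_lmul[OF bilinear_g]) simp
    ultimately have f: "unitary (f # fs)"
      using less.prems by (simp add: unitary_Cons)
    then have "independent (set (real_frame (f # fs)))" "card (set (real_frame (f # fs))) = 2 * length (f # fs)"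
      using orthonormal_real_frame[OF f] orthonormal_independent
      by (auto simp only: distinct_card length_real_frame)
    then have "length (f # fs) \<le> n"
      using finite_dim_independent_bound[of "set (real_frame (f # fs))"] dim by simp
    then have "n - length (f # fs) < n - length fs" by simp
    then obtain hs where "unitary (hs @ f # fs)" "length (hs @ f # fs) = n"
      "span (set (real_frame (hs @ f # fs))) = UNIV"
      using less.hyps[of "f # fs"] f by blast
    then show ?thesis by (intro exI[of _ "hs @ [f]"]) simp
  qed
qed

section \<open>Conformally invariant symmetrizations\<close>

text \<open>The form \<open>s\<close> is the symmetrization of \<open>A\<close>, and \<open>s (A x) y + s x (A y)\<close> is its derivative
  under the flow of \<open>A\<close>. In an orthonormal basis \<open>a\<close> and \<open>s = a + a\<^sup>T\<close> are matrices, and twice the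
  trace of \<open>a s\<close> is \<open>\<Sum>s\<^sub>i\<^sub>j\<^sup>2\<close> because \<open>s\<close> is symmetric. The conformal relation turns the trace of
  \<open>a s\<close> into a multiple of the trace of \<open>a\<close>, so a trace-free \<open>A\<close> is skew.\<close>

lemma symmetrization_zero_if_conformal:
  assumes B: "finite B" "orthonormal B" and A: "\<And>b. b \<in> B \<Longrightarrow> A b \<in> span B"
    and trace: "(\<Sum>b\<in>B. g (A b) b) = 0"
    and s_def: "\<And>x y. s x y = g (A x) y + g x (A y)"
    and conformal: "\<And>x. x \<in> B \<Longrightarrow> s (A x) x + s x (A x) = \<mu> * s x x"
    and linear: "linear A" and b: "b \<in> B" "c \<in> B"
  shows "s b c = 0"
proof -
  have s_commute: "s x y = s y x" for x y
    by (simp add: s_def g_commute[of "A _"])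
  have expand: "s (A x) x = (\<Sum>y\<in>B. g (A x) y * s x y)" if "x \<in> B" for x
  proof -
    have lin: "linear (\<lambda>y. s x y)"
      unfolding s_def by (rule linearI) (simp_all add: linear_add[OF linear] linear_scale[OF linear] algebra_simps)
    have "s (A x) x = s x (\<Sum>y\<in>B. g (A x) y *\<^sub>R y)"
      unfolding s_commute[of "A x"] by (rule arg_cong[OF orthonormal_expansion[OF B A[OF that]]])
    then show ?thesis
      by (simp add: linear_sum[OF lin] linear_scale[OF lin])
  qed
  have "(\<Sum>x\<in>B. s (A x) x) = (\<Sum>x\<in>B. \<mu> * g (A x) x)"
  proof (rule sum.cong[OF refl])
    fix x assume "x \<in> B"
    then show "s (A x) x = \<mu> * g (A x) x"
      using conformal[of x] by (simp add: s_commute[of x "A x"] s_def[of x x] g_commute[of x "A x"])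
  qed
  then have "(\<Sum>x\<in>B. s (A x) x) = 0"
    using trace by (simp add: sum_distrib_left[symmetric])
  then have 1: "(\<Sum>x\<in>B. \<Sum>y\<in>B. g (A x) y * s x y) = 0"
    by (simp add: expand)
  then have 2: "(\<Sum>x\<in>B. \<Sum>y\<in>B. g x (A y) * s x y) = 0"
    by (subst sum.swap) (simp add: s_commute g_commute)
  have "s x y * s x y = g (A x) y * s x y + g x (A y) * s x y" for x y
    by (simp only: s_def[of x y] distrib_right)
  then have "(\<Sum>x\<in>B. \<Sum>y\<in>B. s x y * s x y) = 0"
    using 1 2 by (simp add: sum.distrib)
  then have "(\<Sum>p\<in>B \<times> B. s (fst p) (snd p) * s (fst p) (snd p)) = 0"
    by (simp add: sum.cartesian_product split_def)
  then show ?thesis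
    using B(1) b by (subst (asm) sum_nonneg_eq_0_iff) auto
qed

section \<open>Powers of the fundamental form on unitary frames\<close>

abbreviation fund :: "'a \<Rightarrow> 'a \<Rightarrow> real" where
  "fund x y \<equiv> g (J x) y"

lemma wedge_power_real_frame:
  assumes "unitary fs"
  shows "wedge_power (two_form fund) (length fs) (real_frame fs) = fact (length fs)"
  using assms
proof (induction fs)
  case Nil
  then show ?case by (simp add: unit_form_def)
next
  case (Cons f fs)
  have "unitary fs" "g f f = 1" using Cons.prems by (auto simp: unitary_Cons)
  moreover have "fund (J f) z = 0" if "z \<in> set (real_frame fs)" for z
    using real_frame_orthogonal(1)[OF Cons.prems that] by simp
  ultimately show ?case
    using Cons.IH wedge_power_split_pair[of "real_frame fs" fund "J f" "length fs" f]
    by (simp del: wedge_power.simps)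
qed

text \<open>The left-hand side is the derivation extending \<open>A\<close>, applied to a form of top degree on the
  complex span of the frame; such a derivation acts as multiplication by the trace. In the induction
  the pair \<open>(f, J f)\<close> contributes its two diagonal entries, and in all other terms it splits off as
  a factor.\<close>

lemma derivation_wedge_power_real_frame:
  assumes "unitary fs"
  shows "(\<Sum>j<length (real_frame fs). (-1) ^ j * wedge_power (two_form fund) (length fs)
      (A (real_frame fs ! j) # nths (real_frame fs) (- {j}))) =
    fact (length fs) * (\<Sum>b\<leftarrow>real_frame fs. g (A b) b)"
  using assms
proof (induction fs)
  case Nil
  then show ?case by simp
next
  case (Cons f fs)
  let ?R = "real_frame fs" and ?k = "length fs" and ?W = "wedge_power (two_form fund)"
  have f: "unitary fs" "g f f = 1" using Cons.prems by (auto simp: unitary_Cons)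
  note orth = real_frame_orthogonal[OF Cons.prems]
  \<comment> \<open>The vector that follows \<open>A f\<close> is \<open>J f\<close>, and \<open>\<Omega>(A f, J f) = g(A f, f)\<close>; the alternating sign of the
    second term cancels the one in \<open>\<Omega>(A (J f), f) = - g(A (J f), J f)\<close>.\<close>
  have "?W (Suc ?k) (A f # J f # ?R) = real (Suc ?k) * g (A f) f * fact ?k"
    using wedge_power_split_pair[of ?R fund "J f" ?k "A f"] orth wedge_power_real_frame[OF f(1)]
    by (simp del: wedge_power.simps)
  moreover have "?W (Suc ?k) (A (J f) # f # ?R) = - (real (Suc ?k) * g (A (J f)) (J f) * fact ?k)"
    using wedge_power_split_pair[of ?R fund f ?k "A (J f)"] orth wedge_power_real_frame[OF f(1)]
    by (simp del: wedge_power.simps add: g_J_right)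
  moreover have "?W (Suc ?k) (A (?R ! j) # f # J f # nths ?R (- {j})) =
      real (Suc ?k) * ?W ?k (A (?R ! j) # nths ?R (- {j}))" for j
    using wedge_power_split_later_pair[of "nths ?R (- {j})" fund f "J f" ?k "A (?R ! j)"] orth f(2)
      set_nths_subset[of ?R]
    by (force simp del: wedge_power.simps)
  moreover have "(\<Sum>j<length ?R. (-1) ^ j * (real (Suc ?k) * ?W ?k (A (?R ! j) # nths ?R (- {j})))) =
      real (Suc ?k) * (fact ?k * (\<Sum>b\<leftarrow>?R. g (A b) b))"
    unfolding Cons.IH[OF f(1), symmetric] by (simp only: sum_distrib_left mult.left_commute)
  ultimately show ?case
    by (simp add: sum.lessThan_Suc_shift nths_Cons_Compl del: wedge_power.simps sum.lessThan_Suc of_nat_Suc)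
      (simp add: algebra_simps)
qed

end


section \<open>Almost abelian Lie algebras with a unit normal\<close>

locale almost_abelian_hermitian = hermitian_space J g
  for J :: "'a::real_vector \<Rightarrow> 'a" and g :: "'a \<Rightarrow> 'a \<Rightarrow> real" +
  fixes br :: "'a \<Rightarrow> 'a \<Rightarrow> 'a" and e :: 'a
  assumes bilinear_br: "bilinear br" and br_self [simp]: "br x x = 0"
    and integrable: "br (J x) (J y) - J (br (J x) y) - J (br x (J y)) - br x y = 0"
    and g_e_e [simp]: "g e e = 1"
    and br_abelian: "g x e = 0 \<Longrightarrow> g y e = 0 \<Longrightarrow> br x y = 0"
    and br_ideal: "g y e = 0 \<Longrightarrow> g (br x y) e = 0"
begin

abbreviation D :: "'a \<Rightarrow> 'a" where "D x \<equiv> br e x"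

definition tangent :: "'a \<Rightarrow> bool" where
  "tangent x \<longleftrightarrow> g x e = 0 \<and> g x (J e) = 0"

text \<open>Up to sign, this is the Lie derivative of the fundamental form along \<open>e\<close>.\<close>

definition defect :: "'a \<Rightarrow> 'a \<Rightarrow> real" where
  "defect x y = fund (D x) y + fund x (D y)"

lemmas br_simps [simp] = bilinear_ladd[OF bilinear_br] bilinear_radd[OF bilinear_br]
  bilinear_lsub[OF bilinear_br] bilinear_rsub[OF bilinear_br]
  bilinear_lneg[OF bilinear_br] bilinear_rneg[OF bilinear_br]
  bilinear_lzero[OF bilinear_br] bilinear_rzero[OF bilinear_br]
  bilinear_lmul[OF bilinear_br] bilinear_rmul[OF bilinear_br]

lemma linear_D: "linear D"
  using bilinear_br by (simp add: bilinear_def)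

lemma br_antisym: "br x y = - br y x"
  using br_self[of "x + y"] by (simp del: br_self add: br_self[of x] br_self[of y] add_eq_0_iff)

lemma fund_antisym: "fund x y = - fund y x"
  using g_J_right[of y x] g_commute[of y "J x"] by simp

lemma defect_add_left: "defect (x + y) z = defect x z + defect y z"
  and defect_add_right: "defect x (y + z) = defect x y + defect x z"
  and defect_scale_left: "defect (c *\<^sub>R x) y = c * defect x y"
  and defect_scale_right: "defect x (c *\<^sub>R y) = c * defect x y"
  and defect_neg_left: "defect (- x) y = - defect x y"
  and defect_neg_right: "defect x (- y) = - defect x y"
  and defect_0_left: "defect 0 y = 0"
  and defect_0_right: "defect x 0 = 0"
  by (simp_all add: defect_def algebra_simps)

lemmas defect_simps = defect_add_left defect_add_right defect_scale_left defect_scale_right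
  defect_neg_left defect_neg_right defect_0_left defect_0_right

lemma defect_antisym: "defect x y = - defect y x"
  using fund_antisym[of "D x" y] fund_antisym[of x "D y"] by (simp add: defect_def)

lemma defect_self: "defect x x = 0"
  using defect_antisym[of x x] by simp

text \<open>The components of \<open>x\<close> and \<open>y\<close> in the ideal commute, and \<open>D\<close> kills the normal direction.\<close>

lemma br_eq_D: "br x y = g x e *\<^sub>R D y - g y e *\<^sub>R D x"
proof -
  have "br (x - g x e *\<^sub>R e) (y - g y e *\<^sub>R e) = 0"
    by (rule br_abelian) simp_all
  then show ?thesis
    using br_antisym[of x e] by (simp add: algebra_simps)
qed

text \<open>This is \<open>d\<Omega> = - e\<^sup>* \<and> \<delta>\<close>: by \<open>br_eq_D\<close> each bracket contributes two summands, and skew-symmetry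
  of \<open>\<Omega>\<close> joins those with the same coefficient.\<close>

lemma d_fundamental_form:
  "ce_diff br (two_form fund) [x, y, z] =
    - g x e * defect y z + g y e * defect x z - g z e * defect x y"
proof -
  have "ce_diff br (two_form fund) [x, y, z] = - fund (br x y) z + fund (br x z) y - fund (br y z) x"
    by (simp add: ce_diff_three two_form_def)
  moreover have "defect u v = fund (D u) v - fund (D v) u" for u v
    using fund_antisym[of u "D v"] by (simp add: defect_def)
  ultimately show ?thesis
    unfolding br_eq_D[of x] br_eq_D[of y] by (simp only: g_simps J_simps) (simp add: algebra_simps)
qed

text \<open>If \<open>\<delta>\<close> vanishes on the kernel of \<open>e\<^sup>*\<close>, then \<open>\<delta>\<close> is divisible by \<open>e\<^sup>*\<close>, so \<open>e\<^sup>* \<and> \<delta> = 0\<close>.\<close>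

lemma kaehler_if_defect_zero:
  assumes "\<And>x y. g x e = 0 \<Longrightarrow> g y e = 0 \<Longrightarrow> defect x y = 0"
  shows "kaehler br J g"
proof -
  have split: "defect x y = g x e * defect e y + g y e * defect x e" for x y
  proof -
    have "defect (x + (- g x e) *\<^sub>R e) (y + (- g y e) *\<^sub>R e) = 0"
      by (rule assms) simp_all
    then show ?thesis
      by (simp add: defect_simps defect_self algebra_simps del: scaleR_minus_left)
  qed
  have "ce_diff br (two_form fund) xs = 0" for xs
  proof (cases "length xs = 3")
    case True
    then obtain x y z where "xs = [x, y, z]"
      by (auto simp: eval_nat_numeral length_Suc_conv)
    then show ?thesis
      unfolding \<open>xs = _\<close> d_fundamental_form split[of x y] split[of x z] split[of y z]
        defect_antisym[of e x] defect_antisym[of e y] defect_antisym[of e z]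
      by (simp add: algebra_simps)
  next
    case False
    then show ?thesis by (rule ce_diff_two_form_length)
  qed
  then show ?thesis
    by (simp add: kaehler_def fundamental_form_def zero_form_def fun_eq_iff)
qed

lemma g_J_e [simp]: "g (J x) e = - g x (J e)"
  by (simp add: g_J_right)

lemma tangent_J: "tangent x \<Longrightarrow> tangent (J x)"
  by (simp add: tangent_def)

text \<open>In the integrability condition for \<open>e\<close> and \<open>x\<close> both brackets with \<open>J e\<close> vanish, since \<open>J e\<close>
  lies in the abelian ideal.\<close>

lemma D_J: "tangent x \<Longrightarrow> D (J x) = J (D x)"
proof -
  assume x: "tangent x"
  then have "br (J e) (J x) = 0" "br (J e) x = 0"
    by (auto intro!: br_abelian simp: tangent_def)
  then have "J (D (J x)) = - D x"
    using integrable[of e x] by (simp add: minus_equation_iff)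
  then have "J (J (D (J x))) = - J (D x)"
    by simp
  then show ?thesis by simp
qed

lemma tangent_D: "tangent x \<Longrightarrow> tangent (D x)"
proof -
  assume x: "tangent x"
  have "g (J (D x)) e = 0"
    using br_ideal[of "J x" e] tangent_J[OF x] D_J[OF x] by (simp add: tangent_def)
  then show ?thesis
    using x br_ideal[of x e] by (simp add: tangent_def)
qed

lemma balanced_imp_trace_zero:
  assumes frame: "unitary fs" "\<And>f. f \<in> set (real_frame fs) \<Longrightarrow> tangent f"
    and balanced: "ce_diff br (wedge_power (two_form fund) (length fs)) (e # real_frame fs) = 0"
  shows "(\<Sum>b\<leftarrow>real_frame fs. g (D b) b) = 0"
proof -
  have "br y z = 0" if "y \<in> set (real_frame fs)" "z \<in> set (real_frame fs)" for y z
    using that frame(2) by (auto simp: tangent_def intro: br_abelian)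
  moreover have "wedge_power (two_form fund) (length fs) (0 # ys) = 0" for ys
    by (rule wedge_power_isolated) simp
  ultimately show ?thesis
    using balanced derivation_wedge_power_real_frame[OF frame(1), of D]
    by (simp add: ce_diff_Cons_abelian)
qed

text \<open>The only term of the differential that survives is the one with \<open>[e, J e]\<close>: in every other one
  \<open>J e\<close> remains as an argument, and \<open>\<Omega>(J e, \<cdot>) = - e\<^sup>*\<close> vanishes on the others, which all lie in the ideal.
  In the surviving term \<open>J f\<close> pairs with nothing but \<open>D(J e)\<close>.\<close>

lemma balanced_imp_D_J_e_orthogonal:
  assumes frame: "unitary (f # fs)" "tangent f" "\<And>f. f \<in> set (real_frame fs) \<Longrightarrow> tangent f"
    and balanced: "ce_diff br (wedge_power (two_form fund) (Suc (length fs)))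
      (e # J e # J f # real_frame fs) = 0"
  shows "g (D (J e)) f = 0"
proof -
  let ?R = "J f # real_frame fs" and ?k = "length fs" and ?W = "wedge_power (two_form fund)"
  have tan: "tangent y" if "y \<in> set ?R" for y
    using that frame by (auto intro: tangent_J)
  have normal: "g y e = 0" if "y \<in> set (J e # ?R)" for y
    using that tan by (auto simp: tangent_def simp del: g_J_e)
  have zero: "?W (Suc ?k) (0 # ys) = 0" for ys
    by (rule wedge_power_isolated) simp
  have later: "?W (Suc ?k) (D (?R ! j) # J e # nths ?R (- {j})) = 0" if "j < length ?R" for j
  proof -
    have "fund (J e) z = 0" if "z \<in> set (nths ?R (- {j}))" for z
      using that normal[of z] set_nths_subset[of ?R] g_commute[of z e] by (auto simp del: set_nths_subset)
    moreover have "fund (D (?R ! j)) (J e) = 0"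
      using tangent_D[OF tan[OF nth_mem[OF that]]] by (simp add: tangent_def)
    ultimately show ?thesis
      by (subst wedge_power_split_pair) simp_all
  qed
  have "br y z = 0" if "y \<in> set (J e # ?R)" "z \<in> set (J e # ?R)" for y z
    using that normal by (intro br_abelian)
  then have "ce_diff br (?W (Suc ?k)) (e # J e # ?R) =
      - (\<Sum>j<Suc (length ?R). (-1) ^ j * ?W (Suc ?k) (D ((J e # ?R) ! j) # nths (J e # ?R) (- {j})))"
    using ce_diff_Cons_abelian[of "J e # ?R" br "?W (Suc ?k)" e] zero by simp
  also have "\<dots> = - ?W (Suc ?k) (D (J e) # ?R)"
    unfolding sum.lessThan_Suc_shift using later by (simp add: nths_Cons_Compl del: wedge_power.simps length_Cons)
  also have "\<dots> = - (real (Suc ?k) * g (D (J e)) f * fact ?k)"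
  proof -
    have "fund (J f) z = 0" if "z \<in> set (real_frame fs)" for z
      using real_frame_orthogonal[OF frame(1) that] by simp
    moreover have "unitary fs" using frame(1) by (simp add: unitary_Cons)
    ultimately show ?thesis
      by (simp add: wedge_power_split_pair wedge_power_real_frame del: wedge_power.simps)
  qed
  finally show ?thesis using balanced by simp
qed

text \<open>The torsion \<open>H\<close> has the form \<open>- (J e)\<^sup>* \<and> \<delta>(J \<cdot>, J \<cdot>)\<close>, where \<open>(J e)\<^sup>* = g(\<cdot>, J e)\<close>. On the list
  \<open>[e, J e, u, v]\<close> with \<open>u\<close> and \<open>v\<close> tangent, the right-hand side \<open>\<alpha> \<and> H\<close> keeps only the term with
  \<open>\<alpha> e\<close>: none of \<open>e\<close>, \<open>u\<close>, \<open>v\<close> has a component along \<open>J e\<close>, so \<open>H(e, u, v) = 0\<close>, and \<open>perp\<close> removes the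
  terms with \<open>H(e, J e, \<cdot>)\<close>. On the left, \<open>D\<close> acts on \<open>J e\<close>, \<open>u\<close> and \<open>v\<close>; its
  action on \<open>J e\<close> only contributes the component along \<open>J e\<close>, which goes into \<open>\<mu>\<close>.\<close>

lemma lcskt_imp_defect_conformal:
  assumes perp: "\<And>y. tangent y \<Longrightarrow> defect (J e) y = 0" and "lcskt br J g"
  obtains \<mu> where
    "\<And>x y. tangent x \<Longrightarrow> tangent y \<Longrightarrow> defect (D x) y + defect x (D y) = \<mu> * defect x y"
proof -
  let ?H = "bismut_torsion br J g"
  obtain \<alpha> where \<alpha>: "ce_diff br ?H = wedge (one_form \<alpha>) ?H"
    using assms(2) by (auto simp: lcskt_def)
  have H: "?H [x, y, z] =
    - (g x (J e) * defect (J y) (J z) - g y (J e) * defect (J x) (J z) + g z (J e) * defect (J x) (J y))"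
    for x y z
    by (simp add: bismut_torsion_def fundamental_form_def d_fundamental_form)
  have *: "defect (D x) y + defect x (D y) = - (g (D (J e)) (J e) + \<alpha> e) * defect x y"
    if "tangent x" "tangent y" for x y
  proof -
    \<comment> \<open>As \<open>H\<close> involves \<open>\<delta>(J \<cdot>, J \<cdot>)\<close>, it is evaluated on the preimages of \<open>x\<close> and \<open>y\<close> under \<open>J\<close>.\<close>
    define u where "u = - J x"
    define v where "v = - J y"
    have J: "J u = x" "J v = y" by (simp_all add: u_def v_def)
    have tan: "tangent u" "tangent v"
      using tangent_J[OF that(1)] tangent_J[OF that(2)] by (simp_all add: u_def v_def tangent_def)
    have "br (J e) u = 0" "br (J e) v = 0" "br u v = 0"
      using tan by (auto intro!: br_abelian simp: tangent_def)
    moreover have "J (D u) = D x" "J (D v) = D y"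
      using D_J[OF tan(1)] D_J[OF tan(2)] J by simp_all
    moreover have "g u (J e) = 0" "g v (J e) = 0" "g (D u) (J e) = 0" "g (D v) (J e) = 0"
      using tan tangent_D by (auto simp: tangent_def)
    ultimately have "ce_diff br ?H [e, J e, u, v] =
        g (D (J e)) (J e) * defect x y + defect (D x) y - defect (D y) x"
      by (simp add: ce_diff_four H J defect_simps)
    moreover have "wedge (one_form \<alpha>) ?H [e, J e, u, v] = - \<alpha> e * defect x y"
      using \<open>g u (J e) = 0\<close> \<open>g v (J e) = 0\<close> perp[OF that(1)] perp[OF that(2)]
      by (simp add: wedge_one_form_Cons wedge_one_form_Nil contract_def H J)
    ultimately show ?thesis
      using defect_antisym[of "D y" x] by (simp add: \<alpha> algebra_simps)
  qed
  then show ?thesis using that by blast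
qed

text \<open>For \<open>n = 1\<close> there are no tangent vectors except \<open>0\<close>, and the frame \<open>fs\<close> in the proof is empty; the
  argument covers this case as well.\<close>

theorem balanced_lcskt_imp_kaehler:
  assumes dim: "dim (UNIV :: 'a set) = 2 * n" "n > 0"
    and balanced: "balanced br J g n" and lcskt: "lcskt br J g"
  shows "kaehler br J g"
proof -
  have d0: "ce_diff br (wedge_power (two_form fund) (n - 1)) xs = 0" for xs
  proof -
    have "wedge (one_form (\<lambda>x. 0)) \<beta> xs = 0" for \<beta> :: "'a form"
      by (rule wedge_one_form_eq_0) simp
    then show ?thesis
      using balanced by (auto simp: balanced_def is_lee_form_def fundamental_form_def)
  qed
  have tangent_frame: "tangent y" if "unitary (fs @ [e])" "y \<in> set (real_frame fs)" for fs y
  proof -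
    have "g z e = 0 \<and> g z (J e) = 0" if "z \<in> set fs" for z
      using that \<open>unitary (fs @ [e])\<close> by (auto simp: unitary_def sorted_wrt_append)
    then show ?thesis
      using \<open>y \<in> _\<close> by (auto simp: set_real_frame tangent_def)
  qed
  have perp_D: "g (D (J e)) f = 0" if f: "tangent f" "g f f = 1" for f
  proof -
    \<comment> \<open>Extending \<open>[f, e]\<close> and then leaving out \<open>e\<close> gives a unitary frame of the tangent space that
      contains the given \<open>f\<close>.\<close>
    have "unitary [f, e]" using f by (simp add: unitary_def tangent_def)
    then obtain hs where hs: "unitary (hs @ [f, e])" "length (hs @ [f, e]) = n"
      using unitary_frame_extends[OF dim] by blast
    have "g f h = 0 \<and> g f (J h) = 0" if "g h f = 0" "g h (J f) = 0" for h
      using that g_commute[of f h] g_J_right[of f h] g_commute[of "J f" h] by simp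
    then have "unitary (f # hs)" "unitary (hs @ [e])"
      using hs(1) by (auto simp: unitary_def sorted_wrt_append)
    moreover have "n - 1 = Suc (length hs)" using hs(2) by simp
    ultimately show ?thesis
      using balanced_imp_D_J_e_orthogonal[of f hs] f(1) tangent_frame d0 by metis
  qed
  have perp: "defect (J e) y = 0" if y: "tangent y" for y
  proof -
    have "g (D (J e)) z = 0" if "tangent z" for z
    proof (cases "z = 0")
      case False
      then have "g ((1 / sqrt (g z z)) *\<^sub>R z) ((1 / sqrt (g z z)) *\<^sub>R z) = 1"
        using g_pos[of z] by simp
      moreover have "tangent ((1 / sqrt (g z z)) *\<^sub>R z)"
        using that by (simp add: tangent_def)
      ultimately have "g (D (J e)) ((1 / sqrt (g z z)) *\<^sub>R z) = 0" by (intro perp_D)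
      then show ?thesis using g_pos[OF False] by simp
    qed simp
    then have "fund (D (J e)) y = 0"
      using g_J_right[of "D (J e)" y] tangent_J[OF y] by simp
    then show ?thesis
      using tangent_D[OF y] by (simp add: defect_def tangent_def g_commute[of e])
  qed
  obtain \<mu> where \<mu>: "\<And>x y. tangent x \<Longrightarrow> tangent y \<Longrightarrow>
      defect (D x) y + defect x (D y) = \<mu> * defect x y"
    using lcskt_imp_defect_conformal[OF perp lcskt] by blast
  obtain fs where fs: "unitary (fs @ [e])" "length (fs @ [e]) = n"
    "span (set (real_frame (fs @ [e]))) = UNIV"
    using unitary_frame_extends[OF dim, of "[e]"] by (auto simp: unitary_def)
  let ?B = "set (real_frame fs)"
  have unitary_fs: "unitary fs" using fs(1) by (simp add: unitary_def sorted_wrt_append)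
  have B: "orthonormal ?B" "distinct (real_frame fs)"
    using orthonormal_real_frame[OF unitary_fs] by auto
  have tanB: "tangent b" if "b \<in> ?B" for b
    using tangent_frame[OF fs(1) that] .
  have span_B: "x \<in> span ?B" if "tangent x" for x
  proof -
    let ?B' = "set (real_frame (fs @ [e]))"
    have "x = (\<Sum>b\<in>?B'. g x b *\<^sub>R b)"
      by (rule orthonormal_expansion) (use orthonormal_real_frame[OF fs(1)] fs(3) in auto)
    also have "\<dots> \<in> span ?B"
    proof (rule span_sum)
      fix b assume "b \<in> ?B'"
      then have "b \<in> ?B \<or> g x b = 0"
        using that by (auto simp: set_real_frame tangent_def)
      then show "g x b *\<^sub>R b \<in> span ?B"
        by (auto intro: span_scale span_base simp: span_zero)
    qed
    finally show ?thesis .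
  qed
  have trace: "(\<Sum>b\<in>?B. g (D b) b) = 0"
  proof -
    have "length fs = n - 1" using fs(2) by simp
    then show ?thesis
      using balanced_imp_trace_zero[OF unitary_fs tanB] d0 B(2)
      by (simp add: sum_list_distinct_conv_sum_set)
  qed
  define s where "s x y = g (D x) y + g x (D y)" for x y
  have s_defect: "s x y = - defect (J x) y" if "tangent x" for x y
    using that by (simp add: s_def defect_def D_J)
  have s_frame: "s b c = 0" if "b \<in> ?B" "c \<in> ?B" for b c
  proof (rule symmetrization_zero_if_conformal[OF _ B(1) _ trace s_def _ linear_D that])
    fix x assume "x \<in> ?B"
    then have x: "tangent x" by (rule tanB)
    show "D x \<in> span ?B" using x by (intro span_B tangent_D)
    show "s (D x) x + s x (D x) = \<mu> * s x x"
      using \<mu>[OF tangent_J[OF x] x] x by (simp add: s_defect tangent_D D_J)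
  qed simp
  have "linear (s x)" "linear (\<lambda>x. s x y)" for x y
    by (rule linearI; simp add: s_def algebra_simps)+
  then have "s x y = 0" if "x \<in> span ?B" "y \<in> span ?B" for x y
    using s_frame that linear_eq_0_on_span[of "s _" ?B y] linear_eq_0_on_span[of "\<lambda>x. s x y" ?B x]
    by metis
  then have defect_tangent: "defect x y = 0" if "tangent x" "tangent y" for x y
    using s_defect[OF tangent_J[OF that(1)], of y] span_B tangent_J that
    by (simp add: defect_neg_left)
  show ?thesis
  proof (rule kaehler_if_defect_zero)
    fix x y assume xy: "g x e = 0" "g y e = 0"
    define x' where "x' = x - g x (J e) *\<^sub>R J e"
    define y' where "y' = y - g y (J e) *\<^sub>R J e"
    have tan: "tangent x'" "tangent y'"
      using xy by (simp_all add: tangent_def x'_def y'_def)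
    have "defect (x' + g x (J e) *\<^sub>R J e) (y' + g y (J e) *\<^sub>R J e) = 0"
      using defect_tangent[OF tan] perp[OF tan(1)] perp[OF tan(2)] defect_antisym[of x' "J e"]
      by (simp add: defect_simps defect_self)
    then show "defect x y = 0"
      by (simp add: x'_def y'_def)
  qed
qed

end


theorem proposition4p2:
  fixes br :: "'a::real_vector \<Rightarrow> 'a \<Rightarrow> 'a"
    and J :: "'a \<Rightarrow> 'a"
    and g :: "'a \<Rightarrow> 'a \<Rightarrow> real"
    and n :: nat
  assumes "real_lie_algebra br"
    and "dim (UNIV :: 'a set) = 2 * n"
    and "almost_abelian br"
    and "hermitian_structure br J g"
    and "balanced br J g n"
    and "lcskt br J g"
  shows "kaehler br J g"
proof -
  interpret real_lie_algebra br by fact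
  interpret hermitian_space J g
    using assms(4) by (simp add: hermitian_space_def hermitian_structure_def complex_structure_def)
  obtain I where I: "lie_ideal br I" "\<And>x y. x \<in> I \<Longrightarrow> y \<in> I \<Longrightarrow> br x y = 0"
    "dim (UNIV :: 'a set) = dim I + 1"
    using assms(3) by (auto simp: almost_abelian_def)
  then obtain e where e: "g e e = 1" "\<And>y. y \<in> I \<longleftrightarrow> g y e = 0"
    using hyperplane_unit_normal[of I] by (auto simp: lie_ideal_def)
  interpret almost_abelian_hermitian J g br e
    using assms(4) I e bilinear_br br_self
    by unfold_locales (auto simp: hermitian_structure_def complex_structure_def lie_ideal_def)
  show ?thesis
    using balanced_lcskt_imp_kaehler assms(2,5,6) I(3) by simp
qed

end
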